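(* There is a universal constant $c>0$ such that for all integers $n,k\ge 1$, every function $f\colon\{0,1\}^n\to\{0,1\}$, every $\lambda\in(0,1]$, every $\lambda$-bounded product distribution $\mu$ over $\{0,1\}^n$, and every $\epsilon\ge 0$, $$\overline{\mathsf{D}}_{\epsilon}(f^k,\mu^k)\;\ge\; c\cdot k\lambda\cdot\overline{\mathsf{D}}_{\epsilon}(f,\mu).$$
   Context: Inner products are over $\mathbb{F}_2$: $\langle a,x\rangle=\sum_i a_ix_i \bmod 2$. A deterministic parity decision tree $T$ on $\{0,1\}^N$ is a rooted binary tree in which every internal node is labelled by a vector $a\in\{0,1\}^N$ (the query $\langle a,x\rangle$) and has two children, one for each outcome in $\{0,1\}$, and every leaf is labelled by an output value; $T(x)$ is the label of the leaf reached on input $x$, and $q(T,x)$ is the number of queries made by $T$ on $x$. A randomised parity decision tree $\mathcal{T}$ is a probability distribution over deterministic ones. For $g\colon\{0,1\}^N\to\{0,1\}^m$ and a probability distribution $\nu$ on $\{0,1\}^N$, let $\overline{q}(\mathcal{T},\nu)=\mathbb{E}_{T\sim\mathcal{T},x\sim\nu}[q(T,x)]$, $\mathrm{err}_g(\mathcal{T},\nu)=\Pr_{T\sim\mathcal{T},x\sim\nu}[T(x)\ne g(x)]$, and $\overline{\mathsf{D}}_\epsilon(g,\nu)=\min_{\mathcal{T}}\{\overline{q}(\mathcal{T},\nu):\mathrm{err}_g(\mathcal{T},\nu)\le\epsilon\}$. $f^k\colon(\{0,1\}^n)^k\to\{0,1\}^k$ is $f^k(x^1,\dots,x^k)=(f(x^1),\dots,f(x^k))$,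 and $\mu^k=\mu\times\cdots\times\mu$ ($k$ times). A distribution on $\{0,1\}^n$ is product if it is a product of $n$ independent Bernoulli distributions; a product distribution $\mu$ is $\lambda$-bounded, for $\lambda\in(0,1]$, if $\Pr_{x\sim\mu}[x_i=1]\in[\lambda/2,1-\lambda/2]$ for every $i\in[n]$. *)

theory Defs
  imports "HOL-Probability.Probability" "HOL-Library.Z2"
begin

text \<open>
  For a finite index set \<open>I\<close>, the cube \<open>{0,1}\<^sup>I\<close> is the set of functions into the two-element
  field \<^typ>\<open>bit\<close> that vanish outside \<open>I\<close>. This is the default-value convention of \<^const>\<open>Pi_pmf\<close>,
  so that \<open>Pi_pmf I 0\<close> produces distributions on \<open>{0,1}\<^sup>I\<close>.
\<close>

definition cube :: "'i set \<Rightarrow> ('i \<Rightarrow> bit) set" where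
  "cube I = {x. \<forall>i. i \<notin> I \<longrightarrow> x i = 0}"

definition inner_F2 :: "'i set \<Rightarrow> ('i \<Rightarrow> bit) \<Rightarrow> ('i \<Rightarrow> bit) \<Rightarrow> bit" where
  "inner_F2 I a x = (\<Sum>i\<in>I. a i * x i)"

text \<open>In \<open>Query a T0 T1\<close>, the child for outcome 0 is \<open>T0\<close> and the child for outcome 1 is \<open>T1\<close>.\<close>

datatype ('i, 'o) pdt =
    Leaf 'o
  | Query "'i \<Rightarrow> bit" "('i, 'o) pdt" "('i, 'o) pdt"

fun pdt_on :: "'i set \<Rightarrow> 'o set \<Rightarrow> ('i, 'o) pdt \<Rightarrow> bool" where
  "pdt_on I Y (Leaf y) \<longleftrightarrow> y \<in> Y"
| "pdt_on I Y (Query a T0 T1) \<longleftrightarrow> a \<in> cube I \<and> pdt_on I Y T0 \<and> pdt_on I Y T1"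

fun pdt_out :: "'i set \<Rightarrow> ('i, 'o) pdt \<Rightarrow> ('i \<Rightarrow> bit) \<Rightarrow> 'o" where
  "pdt_out I (Leaf y) x = y"
| "pdt_out I (Query a T0 T1) x =
     (if inner_F2 I a x = 0 then pdt_out I T0 x else pdt_out I T1 x)"

fun pdt_queries :: "'i set \<Rightarrow> ('i, 'o) pdt \<Rightarrow> ('i \<Rightarrow> bit) \<Rightarrow> nat" where
  "pdt_queries I (Leaf y) x = 0"
| "pdt_queries I (Query a T0 T1) x =
     Suc (if inner_F2 I a x = 0 then pdt_queries I T0 x else pdt_queries I T1 x)"

text \<open>
  For finite \<open>I\<close> and \<open>Y\<close> there are only countably many trees satisfying \<open>pdt_on I Y\<close>, so every
  probability distribution over them is given by a \<open>pmf\<close>.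
\<close>

definition rpdt_on :: "'i set \<Rightarrow> 'o set \<Rightarrow> ('i, 'o) pdt pmf \<Rightarrow> bool" where
  "rpdt_on I Y R \<longleftrightarrow> (\<forall>T\<in>set_pmf R. pdt_on I Y T)"

text \<open>
  The depth of the trees in the support of \<open>R\<close> need not be bounded, so the expected number of
  queries can be infinite; hence it is taken in \<^typ>\<open>ennreal\<close>.
\<close>

definition expected_queries :: "'i set \<Rightarrow> ('i, 'o) pdt pmf \<Rightarrow> ('i \<Rightarrow> bit) pmf \<Rightarrow> ennreal" where
  "expected_queries I R \<nu> =
     (\<integral>\<^sup>+ (T, x). of_nat (pdt_queries I T x) \<partial>measure_pmf (pair_pmf R \<nu>))"

definition err ::
  "'i set \<Rightarrow> (('i \<Rightarrow> bit) \<Rightarrow> 'o) \<Rightarrow> ('i, 'o) pdt pmf \<Rightarrow> ('i \<Rightarrow> bit) pmf \<Rightarrow> real" where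
  "err I g R \<nu> = measure_pmf.prob (pair_pmf R \<nu>) {(T, x). pdt_out I T x \<noteq> g x}"

text \<open>
  \<open>Y\<close> is the codomain of \<open>g\<close>. For finite \<open>I\<close> and \<open>Y\<close> the infimum is a minimum: pruning queries
  whose outcome is determined by the earlier ones leaves finitely many trees, and the expected
  number of queries and the error are linear in the distribution on these.
\<close>

definition avg_complexity ::
  "'i set \<Rightarrow> 'o set \<Rightarrow> real \<Rightarrow> (('i \<Rightarrow> bit) \<Rightarrow> 'o) \<Rightarrow> ('i \<Rightarrow> bit) pmf \<Rightarrow> ennreal" where
  "avg_complexity I Y \<epsilon> g \<nu> =
     Inf {expected_queries I R \<nu> | R. rpdt_on I Y R \<and> err I g R \<nu> \<le> \<epsilon>}"

definition product_distribution :: "'i set \<Rightarrow> ('i \<Rightarrow> bit) pmf \<Rightarrow> bool" where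
  "product_distribution I \<mu> \<longleftrightarrow>
     (\<exists>p. (\<forall>i\<in>I. 0 \<le> p i \<and> p i \<le> 1) \<and>
          \<mu> = Pi_pmf I 0 (\<lambda>i. map_pmf of_bool (bernoulli_pmf (p i))))"

definition bounded_product_distribution :: "real \<Rightarrow> 'i set \<Rightarrow> ('i \<Rightarrow> bit) pmf \<Rightarrow> bool" where
  "bounded_product_distribution l I \<mu> \<longleftrightarrow>
     product_distribution I \<mu> \<and>
     (\<forall>i\<in>I. measure_pmf.prob \<mu> {x. x i = 1} \<in> {l / 2 .. 1 - l / 2})"

text \<open>
  A \<open>k\<close>-tuple of elements of \<open>{0,1}\<^sup>I\<close> is a single element of the cube over \<open>{..<k} \<times> I\<close>; its
  \<open>j\<close>-th component is \<open>\<lambda>i. x (j, i)\<close>.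
\<close>

definition fun_power :: "nat \<Rightarrow> (('i \<Rightarrow> bit) \<Rightarrow> bit) \<Rightarrow> (nat \<times> 'i \<Rightarrow> bit) \<Rightarrow> nat \<Rightarrow> bit" where
  "fun_power k f x = (\<lambda>j. if j < k then f (\<lambda>i. x (j, i)) else 0)"

definition pmf_power :: "nat \<Rightarrow> ('i \<Rightarrow> bit) pmf \<Rightarrow> (nat \<times> 'i \<Rightarrow> bit) pmf" where
  "pmf_power k \<mu> = map_pmf (\<lambda>X (j, i). X j i) (Pi_pmf {..<k} (\<lambda>_. 0) (\<lambda>_. \<mu>))"

end

theory Submission
  imports Defs
begin

text \<open>
  Write each bit of a \<open>\<lambda>\<close>-bounded product distribution as a mixture: with probability \<open>\<lambda>\<close> it is a
  \<open>star\<close>, that is, uniform, and otherwise its value is revealed and fixed. When a tree for \<open>f\<^sup>k\<close> makes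
  a query, reveal the coordinates of the query one after the other, starting with the last block,
  until a star \<open>p\<close> is found. Given everything else, the star makes the answer \<open>b\<close> a uniform bit,
  so substituting \<open>b\<close> plus the rest of the query for \<open>x\<^sub>p\<close> in the remaining tree leaves a product
  distribution on the other coordinates. The expected number of coordinates revealed per
  query is at most \<open>1/\<lambda>\<close>.

  To solve one copy of \<open>f\<close>, place it in a uniformly random block \<open>j\<close>. The blocks before \<open>j\<close> are
  sampled in full and the blocks after \<open>j\<close> are only revealed as above, a star there turning the
  answer into a coin flip that is independent of block \<open>j\<close>. The real input is queried only when a
  coordinate of block \<open>j\<close> is reached: once for this coordinate, and once more for the part of
  the query in block \<open>j\<close> if the coordinate turns out to be a star; no later block then occurs in the
  query, so that its answer is known. Hence the costs of the \<open>k\<close> simulations add up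
  to at most twice the number of revealed coordinates.
\<close>

text \<open>These rules would turn linear algebra over the two-element field into Boolean reasoning.\<close>

declare add_bit_eq_xor [simp del] mult_bit_eq_and [simp del]

subsection \<open>Preliminaries on bits and expectations\<close>

lemma bit_add_self [simp]: "b + b = 0" for b :: bit
  by (cases b) simp_all

lemma nn_integral_bit_pmf:
  "(\<integral>\<^sup>+v. g v \<partial>measure_pmf B) = ennreal (pmf B 0) * g 0 + ennreal (pmf B 1) * g 1"
  for B :: "bit pmf"
proof -
  have "(\<integral>\<^sup>+v. g v \<partial>measure_pmf B) = (\<Sum>v\<in>{0,1}. g v * ennreal (pmf B v))"
    by (rule nn_integral_measure_pmf_support)
       (auto intro: bit.exhaust)
  then show ?thesis by (simp add: mult.commute)
qed

lemma nn_integral_pmf_add: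
  "(\<integral>\<^sup>+x. f x + g x \<partial>measure_pmf p) = (\<integral>\<^sup>+x. f x \<partial>measure_pmf p) + (\<integral>\<^sup>+x. g x \<partial>measure_pmf p)"
  by (rule nn_integral_add) simp_all

lemma nn_integral_pmf_cmult:
  "(\<integral>\<^sup>+x. c * f x \<partial>measure_pmf p) = c * (\<integral>\<^sup>+x. f x \<partial>measure_pmf p)"
  by (rule nn_integral_cmult) simp

lemma pmf_bit_sum: "pmf B 0 + pmf B 1 = 1" for B :: "bit pmf"
proof -
  have "UNIV = {0, 1 :: bit}" by auto
  then have "measure_pmf.prob B {0, 1} = 1" by (metis measure_pmf_UNIV)
  then show ?thesis by (simp add: measure_measure_pmf_finite)
qed

lemma ennreal_split:
  assumes "0 \<le> a" "a \<le> b"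
  shows "ennreal b * g = ennreal a * g + ennreal (b - a) * g"
proof -
  have "ennreal b = ennreal a + ennreal (b - a)"
    using assms by (simp flip: ennreal_plus)
  then show ?thesis by (simp add: distrib_right)
qed

text \<open>Here \<open>b\<close> will be the probability of a bit value and \<open>a\<close> the
  share reserved for a star, so \<open>a / b\<close> is the conditional star probability.\<close>

lemma ennreal_mix:
  assumes "0 < a" "a \<le> b"
  shows "ennreal b * (ennreal (a / b) * g + ennreal (1 - a / b) * h)
    = ennreal a * g + ennreal (b - a) * h"
proof -
  have "b * (1 - a / b) = b - a" "b * (a / b) = a"
    using assms by (auto simp: field_simps)
  with assms show ?thesis
    by (simp add: distrib_left mult.assoc[symmetric] flip: ennreal_mult)
qed

subsection \<open>Affine substitution in parity decision trees\<close>

text \<open>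
  The coordinate \<open>p\<close> is replaced by \<open>b\<close> plus the inner product with \<open>r\<close>; the constant term for
  \<open>b = 1\<close> is absorbed by swapping the children.
\<close>

fun pdt_subst :: "'i \<Rightarrow> ('i \<Rightarrow> bit) \<Rightarrow> bit \<Rightarrow> ('i, 'o) pdt \<Rightarrow> ('i, 'o) pdt" where
  "pdt_subst p r b (Leaf y) = Leaf y"
| "pdt_subst p r b (Query a T0 T1) =
     (if a p = 0 then Query a (pdt_subst p r b T0) (pdt_subst p r b T1)
      else if b = 0 then Query (\<lambda>i. (if i = p then 0 else a i) + r i) (pdt_subst p r b T0) (pdt_subst p r b T1)
      else Query (\<lambda>i. (if i = p then 0 else a i) + r i) (pdt_subst p r b T1) (pdt_subst p r b T0))"

lemma inner_F2_upd:
  assumes "finite I" "p \<in> I"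
  shows "inner_F2 I a (x(p := c)) = inner_F2 I (\<lambda>i. if i = p then 0 else a i) x + a p * c"
proof -
  have "inner_F2 I a (x(p := c)) = a p * c + (\<Sum>i\<in>I-{p}. a i * x i)"
    unfolding inner_F2_def by (subst sum.remove[OF assms]) simp
  moreover have "inner_F2 I (\<lambda>i. if i = p then 0 else a i) x = (\<Sum>i\<in>I-{p}. a i * x i)"
    unfolding inner_F2_def by (subst sum.remove[OF assms]) simp
  ultimately show ?thesis by (simp add: add.commute)
qed

lemma inner_F2_add: "inner_F2 I (\<lambda>i. a i + r i) x = inner_F2 I a x + inner_F2 I r x"
  by (simp add: inner_F2_def distrib_right sum.distrib)

lemma inner_F2_cong:
  "(\<And>i. i \<in> I \<Longrightarrow> a i = 1 \<Longrightarrow> x i = y i) \<Longrightarrow> inner_F2 I a x = inner_F2 I a y"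
  unfolding inner_F2_def by (intro sum.cong refl) (metis bit_not_one_iff mult_zero_left)

lemma inner_F2_subst:
  assumes "finite I" "p \<in> I" "a p = 1"
  shows "inner_F2 I (\<lambda>i. (if i = p then 0 else a i) + r i) x + b
    = inner_F2 I a (x(p := b + inner_F2 I r x))"
  unfolding inner_F2_upd[OF assms(1,2)] inner_F2_add using assms(3) by (simp add: ac_simps)

text \<open>Both trees follow the same path: a query containing \<open>p\<close>, evaluated on the
  updated input, is the rewritten query plus \<open>b\<close>, and for \<open>b = 1\<close> the
  swapped children compensate the flipped answer.\<close>

lemma
  assumes "finite I" "p \<in> I"
  shows pdt_out_subst:
      "pdt_out I (pdt_subst p r b T) x = pdt_out I T (x(p := b + inner_F2 I r x))"
    and pdt_queries_subst:
      "pdt_queries I (pdt_subst p r b T) x = pdt_queries I T (x(p := b + inner_F2 I r x))"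
proof -
  define y where "y = x(p := b + inner_F2 I r x)"
  have "pdt_out I (pdt_subst p r b T) x = pdt_out I T y
    \<and> pdt_queries I (pdt_subst p r b T) x = pdt_queries I T y"
  proof (induction T)
    case (Query a T0 T1)
    let ?a = "\<lambda>i. (if i = p then 0 else a i) + r i"
    show ?case
    proof (cases "a p = 0")
      case True
      then have "inner_F2 I a y = inner_F2 I a x"
        unfolding y_def by (intro inner_F2_cong) auto
      with True Query.IH show ?thesis by simp
    next
      case False
      then have "inner_F2 I a y = inner_F2 I ?a x + b"
        unfolding y_def using inner_F2_subst[OF assms] by simp
      with False Query.IH show ?thesis
        by (cases b; cases "inner_F2 I ?a x") simp_all
    qed
  qed simp
  then show "pdt_out I (pdt_subst p r b T) x = pdt_out I T (x(p := b + inner_F2 I r x))"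
    "pdt_queries I (pdt_subst p r b T) x = pdt_queries I T (x(p := b + inner_F2 I r x))"
    by (auto simp: y_def)
qed

lemma pdt_on_subst:
  assumes "r \<in> cube (D - {p})"
  shows "pdt_on D Y T \<Longrightarrow> pdt_on (D - {p}) Y (pdt_subst p r b T)"
proof (induction T)
  case (Query a T0 T1)
  then show ?case using assms
    by (auto simp: cube_def)
qed auto

lemma size_pdt_subst [simp]: "size (pdt_subst p r b T) = size T"
  by (induction T) auto

lemma
  assumes "pdt_on D Y T" "\<And>i. i \<in> D \<Longrightarrow> x i = y i"
  shows pdt_out_cong: "pdt_out I T x = pdt_out I T y"
    and pdt_queries_cong: "pdt_queries I T x = pdt_queries I T y"
proof -
  have "pdt_out I T x = pdt_out I T y \<and> pdt_queries I T x = pdt_queries I T y"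
    using assms(1)
  proof (induction T)
    case (Query a T0 T1)
    then have "inner_F2 I a x = inner_F2 I a y"
      by (intro inner_F2_cong assms(2)) (auto simp: cube_def)
    with Query show ?case by simp
  qed simp
  then show "pdt_out I T x = pdt_out I T y" "pdt_queries I T x = pdt_queries I T y" by auto
qed

lemma pdt_on_mono: "pdt_on D Y T \<Longrightarrow> D \<subseteq> D' \<Longrightarrow> pdt_on D' Y T"
  by (induction T) (auto simp: cube_def)

lemma rpdt_on_mono: "rpdt_on D Y R \<Longrightarrow> D \<subseteq> D' \<Longrightarrow> rpdt_on D' Y R"
  using pdt_on_mono by (fastforce simp: rpdt_on_def)

section \<open>Operations on randomised trees\<close>

definition mix_pmf :: "real \<Rightarrow> 'a pmf \<Rightarrow> 'a pmf \<Rightarrow> 'a pmf" where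
  "mix_pmf \<theta> R S = bind_pmf (bernoulli_pmf \<theta>) (\<lambda>s. if s then R else S)"

lemma nn_integral_mix_pmf:
  "0 \<le> \<theta> \<Longrightarrow> \<theta> \<le> 1 \<Longrightarrow> (\<integral>\<^sup>+t. h t \<partial>mix_pmf \<theta> R S) =
    ennreal \<theta> * (\<integral>\<^sup>+t. h t \<partial>R) + ennreal (1 - \<theta>) * (\<integral>\<^sup>+t. h t \<partial>S)"
  by (simp add: mix_pmf_def mult.commute)

lemma rpdt_on_mix_pmf: "rpdt_on I Y R \<Longrightarrow> rpdt_on I Y S \<Longrightarrow> rpdt_on I Y (mix_pmf \<theta> R S)"
  by (auto simp: mix_pmf_def rpdt_on_def split: if_splits)

text \<open>The two subtrees are drawn independently; a fixed input reaches only one of them, so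
  expectations of its output or query count involve only the law of that subtree.\<close>

definition query_pmf ::
  "('i \<Rightarrow> bit) \<Rightarrow> (bit \<Rightarrow> ('i, 'o) pdt pmf) \<Rightarrow> ('i, 'o) pdt pmf" where
  "query_pmf a R = bind_pmf (R 0) (\<lambda>t0. map_pmf (Query a t0) (R 1))"

lemma rpdt_on_query_pmf:
  "a \<in> cube I \<Longrightarrow> (\<And>v. rpdt_on I Y (R v)) \<Longrightarrow> rpdt_on I Y (query_pmf a R)"
  by (auto simp: query_pmf_def rpdt_on_def)

lemma nn_integral_out_query_pmf:
  "(\<integral>\<^sup>+t. h (pdt_out I t x) \<partial>query_pmf a R) = (\<integral>\<^sup>+t. h (pdt_out I t x) \<partial>R (inner_F2 I a x))"
  by (cases "inner_F2 I a x") (simp_all add: query_pmf_def)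

definition pmf_queries :: "'i set \<Rightarrow> ('i, 'o) pdt pmf \<Rightarrow> ('i \<Rightarrow> bit) \<Rightarrow> ennreal" where
  "pmf_queries I R x = (\<integral>\<^sup>+t. of_nat (pdt_queries I t x) \<partial>R)"

lemma pmf_queries_query_pmf:
  "pmf_queries I (query_pmf a R) x = 1 + pmf_queries I (R (inner_F2 I a x)) x"
  by (cases "inner_F2 I a x") (simp_all add: query_pmf_def pmf_queries_def nn_integral_add)

lemma pmf_queries_mix_pmf:
  "0 \<le> \<theta> \<Longrightarrow> \<theta> \<le> 1 \<Longrightarrow> pmf_queries I (mix_pmf \<theta> R S) x =
    ennreal \<theta> * pmf_queries I R x + ennreal (1 - \<theta>) * pmf_queries I S x"
  unfolding pmf_queries_def by (rule nn_integral_mix_pmf)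

lemma pmf_queries_cong:
  assumes "rpdt_on D Y R" "\<And>i. i \<in> D \<Longrightarrow> x i = y i"
  shows "pmf_queries I R x = pmf_queries I R y"
  unfolding pmf_queries_def
proof (rule nn_integral_cong_AE, rule AE_pmfI)
  fix t assume "t \<in> set_pmf R"
  with assms(1) have "pdt_on D Y t" by (auto simp: rpdt_on_def)
  then show "(of_nat (pdt_queries I t x) :: ennreal) = of_nat (pdt_queries I t y)"
    by (intro arg_cong[where f = of_nat] pdt_queries_cong assms(2))
qed

lemma nn_integral_out_cong:
  assumes "rpdt_on D Y R" "\<And>i. i \<in> D \<Longrightarrow> x i = y i"
  shows "(\<integral>\<^sup>+t. h (pdt_out I t x) \<partial>measure_pmf R) = (\<integral>\<^sup>+t. h (pdt_out I t y) \<partial>measure_pmf R)"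
proof (rule nn_integral_cong_AE, rule AE_pmfI)
  fix t assume "t \<in> set_pmf R"
  with assms(1) have "pdt_on D Y t" by (auto simp: rpdt_on_def)
  then show "h (pdt_out I t x) = h (pdt_out I t y)"
    by (intro arg_cong[where f = h] pdt_out_cong assms(2))
qed

section \<open>Resampling in product distributions\<close>

text \<open>By independence, coordinates inside and outside \<open>A\<close> may come from separate
  samples. This allows sampled, real and fresh blocks to be combined into one input.\<close>

lemma Pi_pmf_merge:
  assumes "finite I"
  shows "map_pmf (\<lambda>(x, z) i. if i \<in> A then x i else z i) (pair_pmf (Pi_pmf I d B) (Pi_pmf I d B))
    = Pi_pmf I d B"
proof -
  let ?P = "Pi_pmf I d B"
  have "Pi_pmf I d B = Pi_pmf ((I \<inter> A) \<union> (I - A)) d B"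
    by (simp add: Int_Diff_Un)
  also have "\<dots> = map_pmf (\<lambda>(f,g) i. if i \<in> I \<inter> A then f i else g i)
      (pair_pmf (Pi_pmf (I \<inter> A) d B) (Pi_pmf (I - A) d B))"
    using assms by (intro Pi_pmf_union) auto
  also have "Pi_pmf (I \<inter> A) d B = map_pmf (\<lambda>f i. if i \<in> I \<inter> A then f i else d) ?P"
    using assms by (intro Pi_pmf_subset) auto
  also have "Pi_pmf (I - A) d B = map_pmf (\<lambda>f i. if i \<in> I - A then f i else d) ?P"
    using assms by (intro Pi_pmf_subset) auto
  also have "map_pmf (\<lambda>(f,g) i. if i \<in> I \<inter> A then f i else g i)
      (pair_pmf (map_pmf (\<lambda>f i. if i \<in> I \<inter> A then f i else d) ?P)
        (map_pmf (\<lambda>f i. if i \<in> I - A then f i else d) ?P))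
    = map_pmf (\<lambda>(x, z) i. if i \<in> A then x i else z i) (pair_pmf ?P ?P)"
    unfolding map_pair[symmetric] map_pmf_comp
  proof (rule map_pmf_cong[OF refl], goal_cases)
    case (1 y)
    moreover obtain x z where y: "y = (x, z)" by (cases y)
    ultimately have "\<And>i. i \<notin> I \<Longrightarrow> x i = d" "\<And>i. i \<notin> I \<Longrightarrow> z i = d"
      using set_Pi_pmf_subset[OF assms, of d B] by auto
    then show ?case
      unfolding y by (auto simp: fun_eq_iff)
  qed
  finally show ?thesis ..
qed

lemma nn_integral_Pi_pmf_merge:
  assumes "finite I"
  shows "(\<integral>\<^sup>+x. \<integral>\<^sup>+z. G (\<lambda>i. if i \<in> A then x i else z i) \<partial>Pi_pmf I d B \<partial>Pi_pmf I d B)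
    = (\<integral>\<^sup>+x. G x \<partial>Pi_pmf I d B)"
  by (subst (3) Pi_pmf_merge[OF assms, symmetric, where A = A])
     (simp add: nn_integral_pair_pmf')

lemma nn_integral_Pi_pmf_resample:
  fixes B :: "'i \<Rightarrow> bit pmf"
  assumes "finite I" "p \<in> I"
  shows "(\<integral>\<^sup>+x. G x \<partial>Pi_pmf I d B) = (\<integral>\<^sup>+x. ennreal (pmf (B p) 0) * G (x(p := 0))
    + ennreal (pmf (B p) 1) * G (x(p := 1)) \<partial>Pi_pmf I d B)"
proof -
  let ?P = "Pi_pmf I d B"
  have "(\<integral>\<^sup>+x. G x \<partial>?P) = (\<integral>\<^sup>+x. \<integral>\<^sup>+z. G (z(p := x p)) \<partial>?P \<partial>?P)"
    by (subst nn_integral_Pi_pmf_merge[OF assms(1), symmetric, where A = "{p}"])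
       (auto intro!: nn_integral_cong arg_cong[where f = G])
  also have "\<dots> = (\<integral>\<^sup>+v. \<integral>\<^sup>+z. G (z(p := v)) \<partial>?P \<partial>map_pmf (\<lambda>x. x p) ?P)"
    by simp
  also have "map_pmf (\<lambda>x. x p) ?P = B p"
    using assms by (simp add: Pi_pmf_component)
  finally show ?thesis
    by (simp only: nn_integral_bit_pmf nn_integral_pmf_add nn_integral_pmf_cmult)
qed

subsection \<open>Simulating one block\<close>

locale bounded_product =
  fixes I :: "'i set" and B :: "'i \<Rightarrow> bit pmf" and l :: real and blk :: "'i \<Rightarrow> nat"
  assumes finite_I: "finite I" and l_pos: "0 < l"
    and pmf_ge: "i \<in> I \<Longrightarrow> l / 2 \<le> pmf (B i) v"
begin

abbreviation P :: "('i \<Rightarrow> bit) pmf" where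
  "P \<equiv> Pi_pmf I 0 B"

text \<open>
  The argument of \<open>R\<close> provides the sampled blocks before \<open>j\<close>, and \<open>z\<close> the blocks after \<open>j\<close>. The set
  \<open>D\<close> contains the coordinates that are neither revealed nor substituted.
\<close>

definition simulates ::
  "'o set \<Rightarrow> 'i set \<Rightarrow> ('i, 'o) pdt \<Rightarrow> nat \<Rightarrow> (('i \<Rightarrow> bit) \<Rightarrow> ('i, 'o) pdt pmf) \<Rightarrow> bool" where
  "simulates Y D T j R \<longleftrightarrow>
    (\<forall>x x'. (\<forall>i\<in>D. blk i < j \<longrightarrow> x i = x' i) \<longrightarrow> R x = R x') \<and>
    (\<forall>x. rpdt_on {i \<in> D. blk i = j} Y (R x)) \<and>
    (\<forall>x (h :: 'o \<Rightarrow> ennreal). (\<integral>\<^sup>+t. h (pdt_out I t x) \<partial>R x)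
      = (\<integral>\<^sup>+z. h (pdt_out I T (\<lambda>i. if j < blk i then z i else x i)) \<partial>P))"

lemma simulatesD:
  assumes "simulates Y D T j R"
  shows "(\<And>i. i \<in> D \<Longrightarrow> blk i < j \<Longrightarrow> x i = x' i) \<Longrightarrow> R x = R x'"
    and "rpdt_on {i \<in> D. blk i = j} Y (R x)"
    and "(\<integral>\<^sup>+t. h (pdt_out I t x) \<partial>R x)
      = (\<integral>\<^sup>+z. h (pdt_out I T (\<lambda>i. if j < blk i then z i else x i)) \<partial>P)"
  using assms unfolding simulates_def by blast+

text \<open>One sample \<open>x\<close> serves as the seed and as the real input: for a simulation,
  \<open>R x\<close> depends only on blocks before \<open>j\<close> and its trees read only block
  \<open>j\<close>, so the two roles use independent coordinates.\<close>

definition cost :: "(('i \<Rightarrow> bit) \<Rightarrow> ('i, 'o) pdt pmf) \<Rightarrow> ennreal" where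
  "cost R = (\<integral>\<^sup>+x. pmf_queries I (R x) x \<partial>P)"

text \<open>
  The conditional probability that a coordinate is a star given its value \<open>v\<close>; it is chosen such
  that value \<open>v\<close> and star occur together with probability \<open>l / 2\<close> for both values.
\<close>

definition star_prob :: "'i \<Rightarrow> bit \<Rightarrow> real" where
  "star_prob p v = l / 2 / pmf (B p) v"

lemma star_prob_bounds:
  assumes "p \<in> I"
  shows "0 \<le> star_prob p v" "star_prob p v \<le> 1"
  using pmf_ge[OF assms, of v] l_pos by (auto simp: star_prob_def divide_le_eq_1)

lemma star_prob_mix:
  assumes "p \<in> I"
  shows "ennreal (pmf (B p) v) * (ennreal (star_prob p v) * g + ennreal (1 - star_prob p v) * h)
    = ennreal (l / 2) * g + ennreal (pmf (B p) v - l / 2) * h"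
  unfolding star_prob_def using pmf_ge[OF assms, of v] l_pos by (intro ennreal_mix) auto

lemma star_prob_mix_same:
  assumes "p \<in> I"
  shows "ennreal (star_prob p v) * g + ennreal (1 - star_prob p v) * g = g"
  using star_prob_bounds[OF assms, of v]
  by (simp flip: distrib_right ennreal_plus)

text \<open>Both star events have weight \<open>l / 2\<close>, so a star stays uniform under the
  shift by \<open>c x\<close>: for \<open>c x = 1\<close> the two star terms change places. With the
  rest of a query as \<open>c x\<close>, the star's bit becomes the answer.\<close>

lemma nn_integral_P_split:
  assumes "p \<in> I"
  shows "(\<integral>\<^sup>+x. G x \<partial>P)
    = ennreal (l / 2) * (\<integral>\<^sup>+x. G (x(p := 0 + c x)) \<partial>P)
      + ennreal (pmf (B p) 0 - l / 2) * (\<integral>\<^sup>+x. G (x(p := 0)) \<partial>P)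
      + (ennreal (l / 2) * (\<integral>\<^sup>+x. G (x(p := 1 + c x)) \<partial>P)
      + ennreal (pmf (B p) 1 - l / 2) * (\<integral>\<^sup>+x. G (x(p := 1)) \<partial>P))"
proof -
  have "ennreal (pmf (B p) 0) * G (x(p := 0)) + ennreal (pmf (B p) 1) * G (x(p := 1))
    = ennreal (l / 2) * G (x(p := 0 + c x)) + ennreal (pmf (B p) 0 - l / 2) * G (x(p := 0))
      + (ennreal (l / 2) * G (x(p := 1 + c x)) + ennreal (pmf (B p) 1 - l / 2) * G (x(p := 1)))" for x
    using ennreal_split[of "l/2" "pmf (B p) 0" "G (x(p := 0))"]
      ennreal_split[of "l/2" "pmf (B p) 1" "G (x(p := 1))"] l_pos pmf_ge[OF assms]
    by (cases "c x") (simp_all add: ac_simps)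
  then show ?thesis
    by (subst nn_integral_Pi_pmf_resample[OF finite_I assms])
       (simp only: nn_integral_pmf_add nn_integral_pmf_cmult)
qed

text \<open>
  \<open>RA\<close> is used if the pivot \<open>p\<close> is a star, \<open>RB\<close> if its value is revealed. Querying \<open>p\<close> and then the
  part of \<open>a\<close> in block \<open>j\<close> costs at most 2, and only if \<open>p\<close> lies in block \<open>j\<close>.
\<close>

lemma simulation_step:
  fixes a :: "'i \<Rightarrow> bit" and T0 T1 :: "('i, 'o) pdt"
  assumes D: "D \<subseteq> I" "p \<in> D" and a: "a \<in> cube D" "a p = 1"
    and max: "\<And>i. a i = 1 \<Longrightarrow> blk i \<le> blk p"
    and RA: "\<And>v. simulates Y (D - {p})
      (pdt_subst p (\<lambda>i. if i = p then 0 else a i) v (if v = 0 then T0 else T1)) j (RA v)"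
    and RB: "\<And>v. simulates Y (D - {p}) (pdt_subst p (\<lambda>_. 0) v (Query a T0 T1)) j (RB v)"
  shows "\<exists>R. simulates Y D (Query a T0 T1) j R \<and>
    cost R \<le> (if j = blk p then 2 else 0)
      + (ennreal (l / 2) * cost (RA 0) + ennreal (pmf (B p) 0 - l / 2) * cost (RB 0)
      + (ennreal (l / 2) * cost (RA 1) + ennreal (pmf (B p) 1 - l / 2) * cost (RB 1)))"
proof -
  let ?T = "Query a T0 T1" and ?\<theta> = "star_prob p"
  define s where "s x = inner_F2 I (\<lambda>i. if i = p then 0 else a i) x" for x
  define m where "m x z = (\<lambda>i. if j < blk i then z i else x i)" for x z :: "'i \<Rightarrow> bit"
  have p: "p \<in> I" using D by auto
  note \<theta> = star_prob_bounds[OF p]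
  have inner_upd: "inner_F2 I a (x(p := v)) = s x + v" for x v
    using a(2) by (simp only: inner_F2_upd[OF finite_I p] s_def mult_1)
  then have inner_a: "inner_F2 I a x = s x + x p" for x
    by (metis fun_upd_triv)
  \<comment> \<open>Substituting \<open>v\<close> plus the rest of the query forces the answer
    \<open>v\<close>, so the law of \<open>RA v\<close> can be expressed by the full tree instead of
    one child.\<close>
  have lawA: "(\<integral>\<^sup>+t. h (pdt_out I t x) \<partial>RA v x)
      = (\<integral>\<^sup>+z. h (pdt_out I ?T ((m x z)(p := v + s (m x z)))) \<partial>P)" for h :: "'o \<Rightarrow> ennreal" and x v
  proof -
    have "inner_F2 I a (y(p := v + s y)) = v" for y
      by (simp only: inner_upd) (cases v; cases "s y"; simp)
    then show ?thesis
      unfolding simulatesD(3)[OF RA] pdt_out_subst[OF finite_I p]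
      by (intro nn_integral_cong arg_cong[where f = h]) (simp add: m_def s_def)
  qed
  have lawB: "(\<integral>\<^sup>+t. h (pdt_out I t x) \<partial>RB v x)
      = (\<integral>\<^sup>+z. h (pdt_out I ?T ((m x z)(p := v))) \<partial>P)" for h :: "'o \<Rightarrow> ennreal" and x v
    unfolding simulatesD(3)[OF RB] pdt_out_subst[OF finite_I p]
    by (simp only: m_def inner_F2_def mult_zero_left sum.neutral_const add_0_right)
  have onA: "rpdt_on {i \<in> D. blk i = j} Y (RA v x)" for v x
    by (rule rpdt_on_mono[OF simulatesD(2)[OF RA]]) auto
  have onB: "rpdt_on {i \<in> D. blk i = j} Y (RB v x)" for v x
    by (rule rpdt_on_mono[OF simulatesD(2)[OF RB]]) auto
  have indep: "pmf_queries I (RA v (x(p := w))) (x(p := w)) = pmf_queries I (RA v x) x"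
    "pmf_queries I (RB v (x(p := w))) (x(p := w)) = pmf_queries I (RB v x) x" for v w x
  proof -
    have "RA v (x(p := w)) = RA v x"
      by (rule simulatesD(1)[OF RA]) auto
    moreover have "RB v (x(p := w)) = RB v x"
      by (rule simulatesD(1)[OF RB]) auto
    ultimately show "pmf_queries I (RA v (x(p := w))) (x(p := w)) = pmf_queries I (RA v x) x"
      "pmf_queries I (RB v (x(p := w))) (x(p := w)) = pmf_queries I (RB v x) x"
      using pmf_queries_cong[OF simulatesD(2)[OF RA], of "x(p := w)" x]
        pmf_queries_cong[OF simulatesD(2)[OF RB], of "x(p := w)" x] by auto
  qed
  \<comment> \<open>For blocks \<open>j\<close> at or after that of \<open>p\<close>, where the
    simulation works with the true answer; \<open>e\<close> is the price of learning it.\<close>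
  have cost_le: "cost R \<le> e
      + (ennreal (l / 2) * cost (RA 0) + ennreal (pmf (B p) 0 - l / 2) * cost (RB 0)
      + (ennreal (l / 2) * cost (RA 1) + ennreal (pmf (B p) 1 - l / 2) * cost (RB 1)))"
    if R: "\<And>x. pmf_queries I (R x) x \<le> e
      + (ennreal (?\<theta> (x p)) * pmf_queries I (RA (inner_F2 I a x) x) x
      + ennreal (1 - ?\<theta> (x p)) * pmf_queries I (RB (x p) x) x)" for R e
  proof -
    define QA where "QA v x = pmf_queries I (RA v x) x" for v x
    define QB where "QB v x = pmf_queries I (RB v x) x" for v x
    define K where "K x = ennreal (?\<theta> (x p)) * QA (inner_F2 I a x) x
      + ennreal (1 - ?\<theta> (x p)) * QB (x p) x" for x
    have K: "ennreal (pmf (B p) v) * K (x(p := v))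
      = ennreal (l / 2) * QA (s x + v) x + ennreal (pmf (B p) v - l / 2) * QB v x" for x v
    proof -
      have "K (x(p := v)) = ennreal (?\<theta> v) * QA (s x + v) x + ennreal (1 - ?\<theta> v) * QB v x"
        unfolding K_def QA_def QB_def indep inner_upd fun_upd_same ..
      then show ?thesis using star_prob_mix[OF p] by simp
    qed
    have "cost R \<le> (\<integral>\<^sup>+x. e + K x \<partial>P)"
      unfolding cost_def K_def QA_def QB_def by (intro nn_integral_mono R)
    also have "\<dots> = e + (\<integral>\<^sup>+x. K x \<partial>P)"
      by (simp add: nn_integral_pmf_add)
    \<comment> \<open>Once \<open>p\<close> is resampled, \<open>s x + v\<close> takes both values
      as \<open>v\<close> does, each with star weight \<open>l / 2\<close>; summing over
      \<open>v\<close> removes the shift.\<close>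
    also have "(\<integral>\<^sup>+x. K x \<partial>P) = (\<integral>\<^sup>+x.
        ennreal (l / 2) * QA 0 x + ennreal (pmf (B p) 0 - l / 2) * QB 0 x
      + (ennreal (l / 2) * QA 1 x + ennreal (pmf (B p) 1 - l / 2) * QB 1 x) \<partial>P)"
      unfolding nn_integral_Pi_pmf_resample[OF finite_I p, where G = K] K
    proof (rule nn_integral_cong)
      fix x
      show "ennreal (l / 2) * QA (s x + 0) x + ennreal (pmf (B p) 0 - l / 2) * QB 0 x
          + (ennreal (l / 2) * QA (s x + 1) x + ennreal (pmf (B p) 1 - l / 2) * QB 1 x)
        = ennreal (l / 2) * QA 0 x + ennreal (pmf (B p) 0 - l / 2) * QB 0 x
          + (ennreal (l / 2) * QA 1 x + ennreal (pmf (B p) 1 - l / 2) * QB 1 x)"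
        by (cases "s x") (simp_all add: ac_simps)
    qed
    finally show ?thesis
      unfolding cost_def QA_def QB_def by (simp only: nn_integral_pmf_add nn_integral_pmf_cmult)
  qed
  \<comment> \<open>As \<open>p\<close> lies in the last block of the query, no block after
    \<open>j\<close> occurs in it and \<open>z\<close> cannot influence the answer.\<close>
  have known: "inner_F2 I a (m x z) = inner_F2 I a x" "m x z p = x p" if "blk p \<le> j" for x z
  proof -
    have "\<not> j < blk i" if "a i = 1" for i
      using max[OF that] \<open>blk p \<le> j\<close> by linarith
    then show "inner_F2 I a (m x z) = inner_F2 I a x"
      by (intro inner_F2_cong) (simp add: m_def)
    show "m x z p = x p" using that by (simp add: m_def)
  qed
  have lawA': "(\<integral>\<^sup>+t. h (pdt_out I t x) \<partial>RA (inner_F2 I a x) x) = (\<integral>\<^sup>+z. h (pdt_out I ?T (m x z)) \<partial>P)"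
    if "blk p \<le> j" for h :: "'o \<Rightarrow> ennreal" and x
  proof -
    \<comment> \<open>With the true answer, the substitution gives \<open>p\<close> its actual value
      back.\<close>
    have "inner_F2 I a x + s (m x z) = m x z p" for z
      using inner_a[of "m x z"] known(1)[OF that, of x z]
      by (cases "s (m x z)"; cases "m x z p") simp_all
    then show ?thesis unfolding lawA by simp
  qed
  have lawB': "(\<integral>\<^sup>+t. h (pdt_out I t x) \<partial>RB (x p) x) = (\<integral>\<^sup>+z. h (pdt_out I ?T (m x z)) \<partial>P)"
    if "blk p \<le> j" for h :: "'o \<Rightarrow> ennreal" and x
  proof -
    have "(m x z)(p := x p) = m x z" for z
      using known(2)[OF that, of x z] by (metis fun_upd_triv)
    then show ?thesis unfolding lawB by simp
  qed
  have D_if: "i \<in> D" if "a i = 1" for i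
    using a(1) that by (auto simp: cube_def)
  consider (above) "j < blk p" | (own) "blk p = j" | (below) "blk p < j" by linarith
  then show ?thesis
  proof cases
    case above
    \<comment> \<open>The sampled bit \<open>v\<close> has two roles: the simulated answer if
      \<open>p\<close> is a star, the revealed value of \<open>p\<close> otherwise.\<close>
    define R where "R x = bind_pmf (B p) (\<lambda>v. mix_pmf (?\<theta> v) (RA v x) (RB v x))" for x
    have int_R: "(\<integral>\<^sup>+t. g t \<partial>R x) =
        ennreal (l / 2) * (\<integral>\<^sup>+t. g t \<partial>RA 0 x) + ennreal (pmf (B p) 0 - l / 2) * (\<integral>\<^sup>+t. g t \<partial>RB 0 x)
      + (ennreal (l / 2) * (\<integral>\<^sup>+t. g t \<partial>RA 1 x)
      + ennreal (pmf (B p) 1 - l / 2) * (\<integral>\<^sup>+t. g t \<partial>RB 1 x))" for g x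
      by (simp only: R_def nn_integral_bind_pmf nn_integral_bit_pmf nn_integral_mix_pmf[OF \<theta>]
          star_prob_mix[OF p])
    have upd: "(m x z)(p := v) = m x (z(p := v))" for x z v
      using above by (auto simp: m_def)
    have "simulates Y D ?T j R"
      unfolding simulates_def
    proof (intro conjI allI impI)
      fix x x' :: "'i \<Rightarrow> bit" assume "\<forall>i\<in>D. blk i < j \<longrightarrow> x i = x' i"
      then have "RA v x = RA v x'" "RB v x = RB v x'" for v
        by (auto intro: simulatesD(1)[OF RA] simulatesD(1)[OF RB])
      then show "R x = R x'" by (simp add: R_def)
    next
      fix x show "rpdt_on {i \<in> D. blk i = j} Y (R x)"
        using onA onB rpdt_on_mix_pmf unfolding R_def rpdt_on_def set_bind_pmf by fast
    next
      fix x and h :: "'o \<Rightarrow> ennreal"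
      \<comment> \<open>The split at \<open>p\<close> is applied with the shift
        \<open>s (m x z)\<close>, the rest of the query on the merged input.\<close>
      have "(\<integral>\<^sup>+z. h (pdt_out I ?T (m x z)) \<partial>P) = (\<integral>\<^sup>+t. h (pdt_out I t x) \<partial>R x)"
        unfolding int_R lawA lawB upd
        by (rule nn_integral_P_split[OF p])
      then show "(\<integral>\<^sup>+t. h (pdt_out I t x) \<partial>R x)
          = (\<integral>\<^sup>+z. h (pdt_out I ?T (\<lambda>i. if j < blk i then z i else x i)) \<partial>P)"
        by (simp only: m_def)
    qed
    moreover have "cost R = ennreal (l / 2) * cost (RA 0) + ennreal (pmf (B p) 0 - l / 2) * cost (RB 0)
      + (ennreal (l / 2) * cost (RA 1) + ennreal (pmf (B p) 1 - l / 2) * cost (RB 1))"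
      unfolding cost_def pmf_queries_def int_R
      by (simp only: nn_integral_pmf_add nn_integral_pmf_cmult)
    ultimately show ?thesis using above by (intro exI[of _ R]) simp
  next
    case own
    define aO where "aO i = (if blk i = j then a i else 0)" for i
    define aL where "aL i = (if blk i < j then a i else 0)" for i
    define e where "e i = (if i = p then 1 else 0 :: bit)" for i
    \<comment> \<open>The unit vector \<open>e\<close> reads \<open>x p\<close>; only for a star is
      \<open>aO\<close> asked too, and its answer \<open>w\<close> is completed by the sampled
      earlier blocks through \<open>aL\<close>.\<close>
    define R where "R x = query_pmf e (\<lambda>v. mix_pmf (?\<theta> v)
      (query_pmf aO (\<lambda>w. RA (w + inner_F2 I aL x) x)) (RB v x))" for x
    have "a i = aO i + aL i" for i
      using max[of i] own by (cases "a i") (auto simp: aO_def aL_def)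
    then have "a = (\<lambda>i. aO i + aL i)" ..
    then have inner_OL: "inner_F2 I aO x + inner_F2 I aL x = inner_F2 I a x" for x
      using inner_F2_add[of I aO aL x] by simp
    have inner_e: "inner_F2 I e x = x p" for x
      unfolding inner_F2_def e_def using finite_I p by (subst sum.remove[OF finite_I p]) simp
    have "simulates Y D ?T j R"
      unfolding simulates_def
    proof (intro conjI allI impI)
      fix x x' :: "'i \<Rightarrow> bit" assume x: "\<forall>i\<in>D. blk i < j \<longrightarrow> x i = x' i"
      then have "RA v x = RA v x'" "RB v x = RB v x'" for v
        by (auto intro: simulatesD(1)[OF RA] simulatesD(1)[OF RB])
      moreover have "inner_F2 I aL x = inner_F2 I aL x'"
        using x D_if by (intro inner_F2_cong) (auto simp: aL_def split: if_splits)
      ultimately show "R x = R x'" by (simp add: R_def)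
    next
      fix x
      have "e \<in> cube {i \<in> D. blk i = j}" using own D by (auto simp: cube_def e_def)
      moreover have "aO \<in> cube {i \<in> D. blk i = j}"
        using a(1) by (auto simp: cube_def aO_def)
      ultimately show "rpdt_on {i \<in> D. blk i = j} Y (R x)"
        unfolding R_def by (intro rpdt_on_query_pmf rpdt_on_mix_pmf onA onB)
    next
      fix x and h :: "'o \<Rightarrow> ennreal"
      have "(\<integral>\<^sup>+t. h (pdt_out I t x) \<partial>R x) = (\<integral>\<^sup>+z. h (pdt_out I ?T (m x z)) \<partial>P)"
        unfolding R_def nn_integral_out_query_pmf inner_e nn_integral_mix_pmf[OF \<theta>] inner_OL
        using own by (simp only: lawA' lawB' order_refl star_prob_mix_same[OF p])
      then show "(\<integral>\<^sup>+t. h (pdt_out I t x) \<partial>R x)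
          = (\<integral>\<^sup>+z. h (pdt_out I ?T (\<lambda>i. if j < blk i then z i else x i)) \<partial>P)"
        by (simp only: m_def)
    qed
    moreover have "pmf_queries I (R x) x \<le> 2
      + (ennreal (?\<theta> (x p)) * pmf_queries I (RA (inner_F2 I a x) x) x
      + ennreal (1 - ?\<theta> (x p)) * pmf_queries I (RB (x p) x) x)" for x
    proof -
      have "pmf_queries I (R x) x = 1 + ennreal (?\<theta> (x p)) * 1
        + (ennreal (?\<theta> (x p)) * pmf_queries I (RA (inner_F2 I a x) x) x
        + ennreal (1 - ?\<theta> (x p)) * pmf_queries I (RB (x p) x) x)"
        unfolding R_def pmf_queries_query_pmf pmf_queries_mix_pmf[OF \<theta>] inner_e inner_OL
          distrib_left by (simp only: ac_simps)
      \<comment> \<open>The second query is made only for a star; its probability is bounded by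
        1.\<close>
      also have "1 + ennreal (?\<theta> (x p)) * 1 \<le> 1 + 1"
        using \<theta>(2) by (intro add_left_mono) (simp add: ennreal_le_1)
      finally show ?thesis by (simp add: add_right_mono one_add_one)
    qed
    ultimately show ?thesis using own cost_le[of R 2] by (intro exI[of _ R]) simp
  next
    case below
    \<comment> \<open>The whole query lies in sampled blocks, so the answer is free; the star is
      still drawn, giving the recursive costs the same weights for every \<open>j\<close>.\<close>
    define R where "R x = mix_pmf (?\<theta> (x p)) (RA (inner_F2 I a x) x) (RB (x p) x)" for x
    have "simulates Y D ?T j R"
      unfolding simulates_def
    proof (intro conjI allI impI)
      fix x x' :: "'i \<Rightarrow> bit" assume x: "\<forall>i\<in>D. blk i < j \<longrightarrow> x i = x' i"
      then have "RA v x = RA v x'" "RB v x = RB v x'" for v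
        by (auto intro: simulatesD(1)[OF RA] simulatesD(1)[OF RB])
      moreover have "inner_F2 I a x = inner_F2 I a x'"
        using x D_if max below by (intro inner_F2_cong) (metis order.strict_trans1)
      moreover have "x p = x' p" using x below D by auto
      ultimately show "R x = R x'" by (simp add: R_def)
    next
      fix x show "rpdt_on {i \<in> D. blk i = j} Y (R x)"
        unfolding R_def by (intro rpdt_on_mix_pmf onA onB)
    next
      fix x and h :: "'o \<Rightarrow> ennreal"
      have "(\<integral>\<^sup>+t. h (pdt_out I t x) \<partial>R x) = (\<integral>\<^sup>+z. h (pdt_out I ?T (m x z)) \<partial>P)"
        unfolding R_def nn_integral_mix_pmf[OF \<theta>]
        using below by (simp only: lawA' lawB' less_imp_le star_prob_mix_same[OF p])
      then show "(\<integral>\<^sup>+t. h (pdt_out I t x) \<partial>R x)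
          = (\<integral>\<^sup>+z. h (pdt_out I ?T (\<lambda>i. if j < blk i then z i else x i)) \<partial>P)"
        by (simp only: m_def)
    qed
    moreover have "pmf_queries I (R x) x \<le> 0
      + (ennreal (?\<theta> (x p)) * pmf_queries I (RA (inner_F2 I a x) x) x
      + ennreal (1 - ?\<theta> (x p)) * pmf_queries I (RB (x p) x) x)" for x
      unfolding R_def pmf_queries_mix_pmf[OF \<theta>] by simp
    ultimately show ?thesis using below cost_le[of R 0] by (intro exI[of _ R]) simp
  qed
qed

section \<open>Amortised cost over all blocks\<close>

text \<open>Each query has budget \<open>2 / l\<close>. A step reveals one coordinate, at cost at
  most 2 in a single block, and with probability \<open>l\<close> it is a star and settles the
  query. Otherwise the query stays pending with one coordinate fewer, hence the term
  \<open>card D\<close> in the induction measure.\<close>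

lemma simulation:
  assumes "finite J"
  shows "pdt_on D Y T \<Longrightarrow> D \<subseteq> I \<Longrightarrow> \<exists>R. (\<forall>j. simulates Y D T j (R j)) \<and>
    (\<Sum>j\<in>J. cost (R j)) \<le> ennreal (2 / l) * (\<integral>\<^sup>+x. of_nat (pdt_queries I T x) \<partial>P)"
proof (induction "size T + card D" arbitrary: T D rule: less_induct)
  case less
  have zero: "inner_F2 I (\<lambda>_. 0) x = 0" for x by (simp add: inner_F2_def)
  have fin: "finite D" using less.prems finite_I finite_subset by blast
  show ?case
  proof (cases T)
    case (Leaf y)
    with less.prems show ?thesis
      by (intro exI[of _ "\<lambda>_ _. return_pmf (Leaf y)"])
         (simp add: simulates_def rpdt_on_def cost_def pmf_queries_def)
  next
    case (Query a T0 T1)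
    have a: "a \<in> cube D" and on: "pdt_on D Y T0" "pdt_on D Y T1"
      using less.prems Query by auto
    show ?thesis
    proof (cases "\<exists>i. a i = 1")
      case False
      \<comment> \<open>A query without coordinates answers 0; any constants from revealed values
        were absorbed by swapping children.\<close>
      then have [simp]: "a = (\<lambda>_. 0)" by (auto simp: fun_eq_iff)
      from less.hyps[of T0 D] on less.prems Query obtain R where
        R: "\<And>j. simulates Y D T0 j (R j)"
        "(\<Sum>j\<in>J. cost (R j)) \<le> ennreal (2 / l) * (\<integral>\<^sup>+x. of_nat (pdt_queries I T0 x) \<partial>P)"
        by auto
      have "simulates Y D T j (R j)" for j
        using R(1)[of j] by (simp add: simulates_def Query zero)
      moreover have "(\<integral>\<^sup>+x. of_nat (pdt_queries I T0 x) \<partial>P )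
          \<le> (\<integral>\<^sup>+x. of_nat (pdt_queries I T x) \<partial>P)"
        unfolding Query by (intro nn_integral_mono) (simp add: zero)
      then have "(\<Sum>j\<in>J. cost (R j))
          \<le> ennreal (2 / l) * (\<integral>\<^sup>+x. of_nat (pdt_queries I T x) \<partial>P)"
        by (intro order_trans[OF R(2)] mult_left_mono) simp_all
      ultimately show ?thesis by blast
    next
      case True
      let ?A = "{i \<in> D. a i = 1}"
      have A: "finite ?A" "?A \<noteq> {}" using True a fin by (auto simp: cube_def)
      then have "Max (blk ` ?A) \<in> blk ` ?A" by (intro Max_in) auto
      \<comment> \<open>One pivot serves all \<open>j\<close>, so the costs can be added term by
        term.\<close>
      then obtain p where p: "p \<in> D" "a p = 1" "blk p = Max (blk ` ?A)" by auto
      have max: "blk i \<le> blk p" if "a i = 1" for i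
        unfolding p(3) using that a A(1) by (intro Max_ge) (auto simp: cube_def)
      have pI: "p \<in> I" using p less.prems by auto
      let ?r = "\<lambda>i. if i = p then 0 else a i"
      define TA where "TA v = pdt_subst p ?r v (if v = 0 then T0 else T1)" for v
      define TB where "TB v = pdt_subst p (\<lambda>_. 0) v T" for v
      have card: "card (D - {p}) < card D" using p(1) fin by (rule card_Diff1_less[rotated])
      have "\<exists>R. (\<forall>j. simulates Y (D - {p}) (TA v) j (R j)) \<and> (\<Sum>j\<in>J. cost (R j))
          \<le> ennreal (2 / l) * (\<integral>\<^sup>+x. of_nat (pdt_queries I (TA v) x) \<partial>P)" for v
        using card on less.prems a unfolding TA_def
        by (intro less.hyps pdt_on_subst) (auto simp: Query cube_def)
      then have "\<exists>R. \<forall>v. (\<forall>j. simulates Y (D - {p}) (TA v) j (R v j)) \<and> (\<Sum>j\<in>J. cost (R v j))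
          \<le> ennreal (2 / l) * (\<integral>\<^sup>+x. of_nat (pdt_queries I (TA v) x) \<partial>P)"
        by (intro choice allI)
      then obtain RA where RA: "\<And>v j. simulates Y (D - {p}) (TA v) j (RA v j)"
        "\<And>v. (\<Sum>j\<in>J. cost (RA v j)) \<le> ennreal (2 / l) * (\<integral>\<^sup>+x. of_nat (pdt_queries I (TA v) x) \<partial>P)"
        by blast
      have "\<exists>R. (\<forall>j. simulates Y (D - {p}) (TB v) j (R j)) \<and> (\<Sum>j\<in>J. cost (R j))
          \<le> ennreal (2 / l) * (\<integral>\<^sup>+x. of_nat (pdt_queries I (TB v) x) \<partial>P)" for v
        using card less.prems unfolding TB_def
        by (intro less.hyps pdt_on_subst) (auto simp: cube_def)
      then have "\<exists>R. \<forall>v. (\<forall>j. simulates Y (D - {p}) (TB v) j (R v j)) \<and> (\<Sum>j\<in>J. cost (R v j))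
          \<le> ennreal (2 / l) * (\<integral>\<^sup>+x. of_nat (pdt_queries I (TB v) x) \<partial>P)"
        by (intro choice allI)
      then obtain RB where RB: "\<And>v j. simulates Y (D - {p}) (TB v) j (RB v j)"
        "\<And>v. (\<Sum>j\<in>J. cost (RB v j)) \<le> ennreal (2 / l) * (\<integral>\<^sup>+x. of_nat (pdt_queries I (TB v) x) \<partial>P)"
        by blast
      define c where "c v = ennreal (pmf (B p) v - l / 2)" for v
      have "\<exists>R. simulates Y D T j R \<and> cost R \<le> (if j = blk p then 2 else 0)
        + (ennreal (l / 2) * cost (RA 0 j) + c 0 * cost (RB 0 j)
        + (ennreal (l / 2) * cost (RA 1 j) + c 1 * cost (RB 1 j)))" for j
      proof -
        have RA': "simulates Y (D - {p}) (pdt_subst p ?r v (if v = 0 then T0 else T1)) j (RA v j)" for v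
          using RA(1)[of v j] by (simp only: TA_def)
        have RB': "simulates Y (D - {p}) (pdt_subst p (\<lambda>_. 0) v (Query a T0 T1)) j (RB v j)" for v
          using RB(1)[of v j] by (simp only: TB_def Query)
        show ?thesis
          unfolding Query c_def
          by (rule simulation_step[where RA = "\<lambda>v. RA v j" and RB = "\<lambda>v. RB v j",
                OF less.prems(2) p(1) a p(2) max RA' RB'])
      qed
      then have "\<exists>R. \<forall>j. simulates Y D T j (R j) \<and> cost (R j) \<le> (if j = blk p then 2 else 0)
        + (ennreal (l / 2) * cost (RA 0 j) + c 0 * cost (RB 0 j)
        + (ennreal (l / 2) * cost (RA 1 j) + c 1 * cost (RB 1 j)))"
        by (intro choice allI)
      then obtain R where R: "\<And>j. simulates Y D T j (R j)"
        "\<And>j. cost (R j) \<le> (if j = blk p then 2 else 0)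
        + (ennreal (l / 2) * cost (RA 0 j) + c 0 * cost (RB 0 j)
        + (ennreal (l / 2) * cost (RA 1 j) + c 1 * cost (RB 1 j)))" by blast
      define qA where "qA v = (\<integral>\<^sup>+x. of_nat (pdt_queries I (TA v) x) \<partial>P)" for v
      define qB where "qB v = (\<integral>\<^sup>+x. of_nat (pdt_queries I (TB v) x) \<partial>P)" for v
      have "(\<Sum>j\<in>J. cost (R j)) \<le> (\<Sum>j\<in>J. (if j = blk p then 2 else 0)
        + (ennreal (l / 2) * cost (RA 0 j) + c 0 * cost (RB 0 j)
        + (ennreal (l / 2) * cost (RA 1 j) + c 1 * cost (RB 1 j))))"
        by (intro sum_mono R(2))
      also have "\<dots> = (\<Sum>j\<in>J. if j = blk p then 2 else 0)
        + (ennreal (l / 2) * (\<Sum>j\<in>J. cost (RA 0 j)) + c 0 * (\<Sum>j\<in>J. cost (RB 0 j))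
        + (ennreal (l / 2) * (\<Sum>j\<in>J. cost (RA 1 j)) + c 1 * (\<Sum>j\<in>J. cost (RB 1 j))))"
        by (simp only: sum.distrib sum_distrib_left)
      also have "\<dots> \<le> ennreal (2 / l) * ennreal l
        + (ennreal (l / 2) * (ennreal (2 / l) * qA 0) + c 0 * (ennreal (2 / l) * qB 0)
        + (ennreal (l / 2) * (ennreal (2 / l) * qA 1) + c 1 * (ennreal (2 / l) * qB 1)))"
      proof (intro add_mono mult_left_mono)
        \<comment> \<open>Only the pivot's block is charged; the 2 is the budget
          \<open>2 / l\<close> times the star probability \<open>l\<close>.\<close>
        have "ennreal (2 / l) * ennreal l = 2"
          using l_pos by (simp flip: ennreal_mult)
        then show "(\<Sum>j\<in>J. if j = blk p then 2 else 0) \<le> ennreal (2 / l) * ennreal l"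
          using assms by simp
      qed (use RA(2) RB(2) in \<open>auto simp: qA_def qB_def\<close>)
      also have "\<dots> = ennreal (2 / l) * (ennreal l
        + (ennreal (l / 2) * qA 0 + c 0 * qB 0 + (ennreal (l / 2) * qA 1 + c 1 * qB 1)))"
        by (simp add: distrib_left mult.left_commute)
      also have "ennreal l + (ennreal (l / 2) * qA 0 + c 0 * qB 0
          + (ennreal (l / 2) * qA 1 + c 1 * qB 1)) = (\<integral>\<^sup>+x. of_nat (pdt_queries I T x) \<partial>P)"
      proof -
        \<comment> \<open>A star settles the query, which is counted here; after a revealed value it
          is still counted inside \<open>TB v\<close>.\<close>
        have A: "of_nat (pdt_queries I T (x(p := v + inner_F2 I ?r x)))
          = 1 + (of_nat (pdt_queries I (TA v) x) :: ennreal)" for x v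
        proof -
          have "inner_F2 I a (x(p := v + inner_F2 I ?r x)) = v"
            unfolding inner_F2_upd[OF finite_I pI] p(2)
            by (cases v; cases "inner_F2 I ?r x") simp_all
          then show ?thesis
            unfolding TA_def Query by (cases v) (simp_all only: pdt_queries.simps if_True if_False
              pdt_queries_subst[OF finite_I pI] of_nat_Suc one_neq_zero refl)
        qed
        have B: "pdt_queries I T (x(p := v)) = pdt_queries I (TB v) x" for x v
          by (simp only: TB_def pdt_queries_subst[OF finite_I pI] zero add_0_right)
        have l: "ennreal l = ennreal (l / 2) + ennreal (l / 2)"
          using l_pos by (simp flip: ennreal_plus)
        have swap: "u + u + (u * x + y + (u * z + w)) = u * (1 + x) + y + (u * (1 + z) + w)"
          for u x y z w :: ennreal
          by (simp add: distrib_left add.assoc add.left_commute)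
        have "(\<integral>\<^sup>+x. of_nat (pdt_queries I T x) \<partial>P)
          = ennreal (l / 2) * (1 + qA 0) + c 0 * qB 0 + (ennreal (l / 2) * (1 + qA 1) + c 1 * qB 1)"
          by (subst nn_integral_P_split[OF pI, where c = "inner_F2 I ?r"], unfold A,
              unfold B nn_integral_pmf_add qA_def qB_def c_def) simp
        then show ?thesis unfolding l swap ..
      qed
      finally show ?thesis using R(1) by blast
    qed
  qed
qed

end

subsection \<open>Embedding a single copy in a random block\<close>

lemma nn_integral_pmf_swap:
  "(\<integral>\<^sup>+a. \<integral>\<^sup>+b. f a b \<partial>measure_pmf N \<partial>measure_pmf M) = (\<integral>\<^sup>+b. \<integral>\<^sup>+a. f a b \<partial>measure_pmf M \<partial>measure_pmf N)"
proof -
  have "(\<integral>\<^sup>+a. \<integral>\<^sup>+b. f a b \<partial>N \<partial>M) = (\<integral>\<^sup>+z. case_prod f z \<partial>pair_pmf M N)"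
    by (simp add: nn_integral_pair_pmf')
  also have "\<dots> = (\<integral>\<^sup>+b. \<integral>\<^sup>+a. f a b \<partial>M \<partial>N)"
    by (subst pair_commute_pmf) (simp add: nn_integral_pair_pmf')
  finally show ?thesis .
qed

lemma expected_queries_eq:
  "expected_queries I R \<nu> = (\<integral>\<^sup>+T. \<integral>\<^sup>+x. of_nat (pdt_queries I T x) \<partial>\<nu> \<partial>R)"
  by (simp add: expected_queries_def nn_integral_pair_pmf')

lemma ennreal_err_eq:
  "ennreal (err I g R \<nu>) = (\<integral>\<^sup>+T. \<integral>\<^sup>+x. of_bool (pdt_out I T x \<noteq> g x) \<partial>\<nu> \<partial>R)"
proof -
  let ?E = "{(T, x). pdt_out I T x \<noteq> g x}"
  have "ennreal (err I g R \<nu>) = (\<integral>\<^sup>+z. indicator ?E z \<partial>pair_pmf R \<nu>)"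
    by (simp add: err_def measure_pmf.emeasure_eq_measure)
  also have "\<dots> = (\<integral>\<^sup>+T. \<integral>\<^sup>+x. of_bool (pdt_out I T x \<noteq> g x) \<partial>\<nu> \<partial>R)"
    by (auto simp: nn_integral_pair_pmf' indicator_def intro!: nn_integral_cong)
  finally show ?thesis .
qed

section \<open>Powers of product distributions\<close>

lemma pmf_power_Pi_pmf:
  fixes B :: "'i \<Rightarrow> bit pmf"
  assumes "finite A"
  shows "pmf_power k (Pi_pmf A 0 B) = Pi_pmf ({..<k} \<times> A) 0 (\<lambda>(j, i). B i)"
proof (rule pmf_eqI)
  fix f :: "nat \<times> 'i \<Rightarrow> bit"
  let ?X = "\<lambda>j i. f (j, i)" and ?g = "\<lambda>(X :: nat \<Rightarrow> 'i \<Rightarrow> bit) (j, i). X j i"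
  have "inj ?g" by (auto simp: inj_def fun_eq_iff)
  then have "pmf (map_pmf ?g M) (?g ?X) = pmf M ?X" for M by (rule pmf_map_inj')
  then have "pmf (pmf_power k (Pi_pmf A 0 B)) f
      = pmf (Pi_pmf {..<k} (\<lambda>_. 0) (\<lambda>_. Pi_pmf A 0 B)) ?X"
    by (simp add: pmf_power_def)
  also have "\<dots> = pmf (Pi_pmf ({..<k} \<times> A) 0 (\<lambda>(j, i). B i)) f"
  proof (cases "\<forall>x. x \<notin> {..<k} \<times> A \<longrightarrow> f x = 0")
    case True
    then have "\<forall>j. j \<notin> {..<k} \<longrightarrow> ?X j = (\<lambda>_. 0)" "\<forall>j i. i \<notin> A \<longrightarrow> f (j, i) = 0" by auto
    with True show ?thesis
      using assms by (simp add: pmf_Pi prod.cartesian_product case_prod_unfold)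
  next
    case False
    \<comment> \<open>A nonzero entry at an excess position has probability 0 on both sides, whether
      \<open>j\<close> or \<open>i\<close> is out of range.\<close>
    then obtain j i where ji: "f (j, i) \<noteq> 0" "j \<notin> {..<k} \<or> i \<notin> A" by auto
    have "pmf (Pi_pmf {..<k} (\<lambda>_. 0) (\<lambda>_. Pi_pmf A 0 B)) ?X = 0"
    proof (cases "j \<in> {..<k}")
      case True
      then have "pmf (Pi_pmf A 0 B) (?X j) = 0"
        using ji assms by (intro pmf_Pi_outside) auto
      then have "(\<Prod>j<k. pmf (Pi_pmf A 0 B) (?X j)) = 0"
        using True by (intro prod_zero) auto
      then show ?thesis by (simp add: pmf_Pi)
    next
      case False
      moreover have "?X j \<noteq> (\<lambda>_. 0)" using ji(1) by metis
      ultimately show ?thesis by (intro pmf_Pi_outside) auto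
    qed
    with False show ?thesis
      using assms by (simp only: pmf_Pi finite_cartesian_product finite_lessThan if_False)
  qed
  finally show "pmf (pmf_power k (Pi_pmf A 0 B)) f = \<dots>" .
qed

lemma pmf_power_component:
  "j < k \<Longrightarrow> map_pmf (\<lambda>X i. X (j, i)) (pmf_power k \<mu>) = \<mu>"
  by (simp add: pmf_power_def map_pmf_comp Pi_pmf_component)

section \<open>Trees reading a single block\<close>

text \<open>Intended for trees that query only block \<open>j\<close>, where cutting the query
  vectors down to this block loses nothing.\<close>

fun component_pdt :: "'j \<Rightarrow> ('j \<times> 'i, 'j \<Rightarrow> 'o) pdt \<Rightarrow> ('i, 'o) pdt" where
  "component_pdt j (Leaf y) = Leaf (y j)"
| "component_pdt j (Query a T0 T1) = Query (\<lambda>i. a (j, i)) (component_pdt j T0) (component_pdt j T1)"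

lemma inner_F2_component:
  assumes "finite K" "j \<in> K" "a \<in> cube {x \<in> K \<times> A. fst x = j}"
  shows "inner_F2 A (\<lambda>i. a (j, i)) (\<lambda>i. X (j, i)) = inner_F2 (K \<times> A) a X"
proof -
  have "inner_F2 (K \<times> A) a X = (\<Sum>j'\<in>K. \<Sum>i\<in>A. a (j', i) * X (j', i))"
    by (simp add: inner_F2_def sum.cartesian_product)
  also have "\<dots> = (\<Sum>i\<in>A. a (j, i) * X (j, i)) + (\<Sum>j'\<in>K-{j}. \<Sum>i\<in>A. a (j', i) * X (j', i))"
    by (rule sum.remove[OF assms(1,2)])
  also have "(\<Sum>j'\<in>K-{j}. \<Sum>i\<in>A. a (j', i) * X (j', i)) = 0"
    using assms(3) by (intro sum.neutral ballI) (auto simp: cube_def)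
  finally show ?thesis by (simp add: inner_F2_def)
qed

lemma
  assumes "finite K" "j \<in> K" "pdt_on {x \<in> K \<times> A. fst x = j} Y t"
  shows pdt_on_component: "pdt_on A UNIV (component_pdt j t)"
    and pdt_out_component:
      "pdt_out A (component_pdt j t) (\<lambda>i. X (j, i)) = pdt_out (K \<times> A) t X j"
    and pdt_queries_component:
      "pdt_queries A (component_pdt j t) (\<lambda>i. X (j, i)) = pdt_queries (K \<times> A) t X"
proof -
  have "pdt_on A UNIV (component_pdt j t) \<and>
      pdt_out A (component_pdt j t) (\<lambda>i. X (j, i)) = pdt_out (K \<times> A) t X j \<and>
      pdt_queries A (component_pdt j t) (\<lambda>i. X (j, i)) = pdt_queries (K \<times> A) t X"
    using assms(3)
  proof (induction t)
    case (Query a T0 T1)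
    then have "a \<in> cube {x \<in> K \<times> A. fst x = j}" by simp
    moreover from this have "(\<lambda>i. a (j, i)) \<in> cube A" by (auto simp: cube_def)
    ultimately show ?case
      using Query inner_F2_component[OF assms(1,2), of a A X] by simp
  qed simp
  then show "pdt_on A UNIV (component_pdt j t)"
    "pdt_out A (component_pdt j t) (\<lambda>i. X (j, i)) = pdt_out (K \<times> A) t X j"
    "pdt_queries A (component_pdt j t) (\<lambda>i. X (j, i)) = pdt_queries (K \<times> A) t X" by auto
qed

text \<open>Averaging over a uniform block turns the bound on the total cost into a gain of a factor
  \<open>k\<close>; the error bound holds for each block separately.\<close>

lemma component_simulation:
  fixes B :: "'i \<Rightarrow> bit pmf" and A :: "'i set" and k :: nat
  defines "\<mu> \<equiv> Pi_pmf A 0 B" and "I \<equiv> {..<k} \<times> A"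
  assumes "finite A" "0 < l" "0 < k" "\<And>i v. i \<in> A \<Longrightarrow> l / 2 \<le> pmf (B i) v"
    and T: "pdt_on I (cube {..<k}) T"
  shows "\<exists>S. rpdt_on A UNIV S \<and>
    (\<integral>\<^sup>+t. \<integral>\<^sup>+x. of_nat (pdt_queries A t x) \<partial>\<mu> \<partial>S)
      \<le> ennreal (2 / (l * real k)) * (\<integral>\<^sup>+x. of_nat (pdt_queries I T x) \<partial>pmf_power k \<mu>) \<and>
    (\<integral>\<^sup>+t. \<integral>\<^sup>+x. of_bool (pdt_out A t x \<noteq> f x) \<partial>\<mu> \<partial>S)
      \<le> (\<integral>\<^sup>+x. of_bool (pdt_out I T x \<noteq> fun_power k f x) \<partial>pmf_power k \<mu>)"
proof -
  interpret bounded_product I "\<lambda>(j, i). B i" l fst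
    using assms by unfold_locales auto
  have P: "pmf_power k \<mu> = P"
    unfolding \<mu>_def I_def by (rule pmf_power_Pi_pmf[OF \<open>finite A\<close>])
  have mu: "(\<integral>\<^sup>+x. F x \<partial>\<mu>) = (\<integral>\<^sup>+X. F (\<lambda>i. X (j, i)) \<partial>P)" if "j < k" for F j
    using arg_cong[OF pmf_power_component[OF that, of \<mu>], of "\<lambda>p. \<integral>\<^sup>+x. F x \<partial>measure_pmf p"]
    by (simp add: P)
  obtain R where R: "\<And>j. simulates (cube {..<k}) I T j (R j)"
    "(\<Sum>j<k. cost (R j)) \<le> ennreal (2 / l) * (\<integral>\<^sup>+x. of_nat (pdt_queries I T x) \<partial>P)"
    using simulation[OF finite_lessThan T order_refl, of k] by auto
  define S where "S = bind_pmf (pmf_of_set {..<k})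
    (\<lambda>j. bind_pmf P (\<lambda>y. map_pmf (component_pdt j) (R j y)))"
  have k: "finite {..<k}" "{..<k} \<noteq> {}" using \<open>0 < k\<close> by auto
  have on: "pdt_on {x \<in> I. fst x = j} (cube {..<k}) t" if "t \<in> set_pmf (R j y)" for j y t
    using simulatesD(2)[OF R(1)] that by (auto simp: rpdt_on_def)
  \<comment> \<open>The single input is realised as component \<open>j\<close> of a sample
    \<open>X\<close>, independent of the seed \<open>y\<close>.\<close>
  have int_S: "(\<integral>\<^sup>+t. \<integral>\<^sup>+x. F t x \<partial>\<mu> \<partial>S)
      = (\<Sum>j<k. \<integral>\<^sup>+X. \<integral>\<^sup>+y. \<integral>\<^sup>+t. F (component_pdt j t) (\<lambda>i. X (j, i)) \<partial>R j y \<partial>P \<partial>P) / of_nat k"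
    for F :: "_ \<Rightarrow> _ \<Rightarrow> ennreal"
  proof -
    have "(\<integral>\<^sup>+t. \<integral>\<^sup>+x. F t x \<partial>\<mu> \<partial>S)
      = (\<Sum>j<k. \<integral>\<^sup>+y. \<integral>\<^sup>+t. \<integral>\<^sup>+x. F (component_pdt j t) x \<partial>\<mu> \<partial>R j y \<partial>P) / of_nat k"
      using k by (simp add: S_def nn_integral_pmf_of_set)
    also have "(\<Sum>j<k. \<integral>\<^sup>+y. \<integral>\<^sup>+t. \<integral>\<^sup>+x. F (component_pdt j t) x \<partial>\<mu> \<partial>R j y \<partial>P)
      = (\<Sum>j<k. \<integral>\<^sup>+X. \<integral>\<^sup>+y. \<integral>\<^sup>+t. F (component_pdt j t) (\<lambda>i. X (j, i)) \<partial>R j y \<partial>P \<partial>P)"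
    proof (rule sum.cong[OF refl])
      fix j assume "j \<in> {..<k}"
      then have "(\<integral>\<^sup>+y. \<integral>\<^sup>+t. \<integral>\<^sup>+x. F (component_pdt j t) x \<partial>\<mu> \<partial>R j y \<partial>P)
        = (\<integral>\<^sup>+y. \<integral>\<^sup>+t. \<integral>\<^sup>+X. F (component_pdt j t) (\<lambda>i. X (j, i)) \<partial>P \<partial>R j y \<partial>P)"
        by (simp only: mu lessThan_iff)
      also have "\<dots> = (\<integral>\<^sup>+y. \<integral>\<^sup>+X. \<integral>\<^sup>+t. F (component_pdt j t) (\<lambda>i. X (j, i)) \<partial>R j y \<partial>P \<partial>P)"
        by (intro nn_integral_cong nn_integral_pmf_swap)
      also have "\<dots> = (\<integral>\<^sup>+X. \<integral>\<^sup>+y. \<integral>\<^sup>+t. F (component_pdt j t) (\<lambda>i. X (j, i)) \<partial>R j y \<partial>P \<partial>P)"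
        by (rule nn_integral_pmf_swap)
      finally show "(\<integral>\<^sup>+y. \<integral>\<^sup>+t. \<integral>\<^sup>+x. F (component_pdt j t) x \<partial>\<mu> \<partial>R j y \<partial>P)
        = (\<integral>\<^sup>+X. \<integral>\<^sup>+y. \<integral>\<^sup>+t. F (component_pdt j t) (\<lambda>i. X (j, i)) \<partial>R j y \<partial>P \<partial>P)" .
    qed
    finally show ?thesis .
  qed
  \<comment> \<open>Seed and input merge into one sample from \<open>P\<close>: it agrees with
    \<open>y\<close> before block \<open>j\<close>, where \<open>R j\<close> looks, and with
    \<open>X\<close> on block \<open>j\<close>, which the trees read.\<close>
  define M where "M j X y = (\<lambda>i. if i \<in> {i. \<not> fst i < j} then X i else y i)"
    for j and X y :: "nat \<times> 'i \<Rightarrow> bit"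
  have int_M: "(\<integral>\<^sup>+X. \<integral>\<^sup>+y. G (M j X y) \<partial>P \<partial>P) = (\<integral>\<^sup>+x. G x \<partial>P)" for G j
    unfolding M_def by (rule nn_integral_Pi_pmf_merge[OF finite_I])
  have R_M: "R j y = R j (M j X y)" for j X y
    by (rule simulatesD(1)[OF R(1)]) (simp add: M_def)
  have "rpdt_on A UNIV S"
    unfolding rpdt_on_def
  proof
    fix t assume "t \<in> set_pmf S"
    then obtain j y t' where t: "j < k" "t' \<in> set_pmf (R j y)" "t = component_pdt j t'"
      using k by (auto simp: S_def)
    then show "pdt_on A UNIV t"
      using pdt_on_component[OF finite_lessThan _ on[OF t(2), unfolded I_def]] by simp
  qed
  moreover have "(\<integral>\<^sup>+t. \<integral>\<^sup>+x. of_nat (pdt_queries A t x) \<partial>\<mu> \<partial>S)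
      \<le> ennreal (2 / (l * real k)) * (\<integral>\<^sup>+x. of_nat (pdt_queries I T x) \<partial>pmf_power k \<mu>)"
  proof -
    have "(\<integral>\<^sup>+X. \<integral>\<^sup>+y. \<integral>\<^sup>+t. of_nat (pdt_queries A (component_pdt j t) (\<lambda>i. X (j, i))) \<partial>R j y \<partial>P \<partial>P)
      = cost (R j)" if "j < k" for j
    proof -
      have "(\<integral>\<^sup>+t. of_nat (pdt_queries A (component_pdt j t) (\<lambda>i. X (j, i))) \<partial>R j y)
        = pmf_queries I (R j (M j X y)) (M j X y)" for X y
      proof -
        have "(\<integral>\<^sup>+t. of_nat (pdt_queries A (component_pdt j t) (\<lambda>i. X (j, i))) \<partial>R j y)
          = pmf_queries I (R j y) X"
          unfolding pmf_queries_def
        proof (rule nn_integral_cong_AE, rule AE_pmfI)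
          fix t assume "t \<in> set_pmf (R j y)"
          from pdt_queries_component[OF finite_lessThan _ on[OF this, unfolded I_def], of X] that
          show "(of_nat (pdt_queries A (component_pdt j t) (\<lambda>i. X (j, i))) :: ennreal)
            = of_nat (pdt_queries I t X)" by (simp add: I_def)
        qed
        also have "\<dots> = pmf_queries I (R j y) (M j X y)"
          by (rule pmf_queries_cong[OF simulatesD(2)[OF R(1)]]) (simp add: M_def)
        finally show ?thesis by (simp only: R_M[of j y X, symmetric])
      qed
      then show ?thesis
        by (simp only: int_M[of "\<lambda>x. pmf_queries I (R j x) x"] cost_def)
    qed
    then have "(\<integral>\<^sup>+t. \<integral>\<^sup>+x. of_nat (pdt_queries A t x) \<partial>\<mu> \<partial>S) = (\<Sum>j<k. cost (R j)) / of_nat k"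
      unfolding int_S by simp
    also have "\<dots> \<le> ennreal (2 / l) * (\<integral>\<^sup>+x. of_nat (pdt_queries I T x) \<partial>P) / of_nat k"
      by (rule divide_right_mono_ennreal[OF R(2)])
    also have "\<dots> = ennreal (2 / l) / of_nat k * (\<integral>\<^sup>+x. of_nat (pdt_queries I T x) \<partial>P)"
      by (simp add: divide_ennreal_def ac_simps)
    also have "ennreal (2 / l) / of_nat k = ennreal (2 / (l * real k))"
      using \<open>0 < l\<close> \<open>0 < k\<close> by (simp add: ennreal_of_nat_eq_real_of_nat divide_ennreal)
    finally show ?thesis by (simp only: P)
  qed
  moreover have "(\<integral>\<^sup>+t. \<integral>\<^sup>+x. of_bool (pdt_out A t x \<noteq> f x) \<partial>\<mu> \<partial>S)
      \<le> (\<integral>\<^sup>+x. of_bool (pdt_out I T x \<noteq> fun_power k f x) \<partial>pmf_power k \<mu>)"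
  proof -
    let ?E = "\<integral>\<^sup>+x. of_bool (pdt_out I T x \<noteq> fun_power k f x) \<partial>P"
    have "(\<integral>\<^sup>+X. \<integral>\<^sup>+y. \<integral>\<^sup>+t. of_bool (pdt_out A (component_pdt j t) (\<lambda>i. X (j, i))
        \<noteq> f (\<lambda>i. X (j, i))) \<partial>R j y \<partial>P \<partial>P) \<le> ?E" if "j < k" for j
    proof -
      have merge_eq: "(\<lambda>i. if i \<in> {i. \<not> j < fst i} then x i else z i)
        = (\<lambda>i. if j < fst i then z i else x i)" for x z :: "nat \<times> 'i \<Rightarrow> bit"
        by auto
      \<comment> \<open>\<open>h\<close> sees its first argument only through block
        \<open>j\<close>, so replacing the later blocks by \<open>z\<close> does not affect the
        correct value.\<close>
      define h :: "(nat \<times> 'i \<Rightarrow> bit) \<Rightarrow> (nat \<Rightarrow> bit) \<Rightarrow> ennreal"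
        where "h x o' = of_bool (o' j \<noteq> f (\<lambda>i. x (j, i)))" for x o'
      have "(\<integral>\<^sup>+t. of_bool (pdt_out A (component_pdt j t) (\<lambda>i. X (j, i)) \<noteq> f (\<lambda>i. X (j, i))) \<partial>R j y)
        = (\<integral>\<^sup>+t. h (M j X y) (pdt_out I t (M j X y)) \<partial>R j (M j X y))" for X y
      proof -
        have "(\<integral>\<^sup>+t. of_bool (pdt_out A (component_pdt j t) (\<lambda>i. X (j, i)) \<noteq> f (\<lambda>i. X (j, i))) \<partial>R j y)
          = (\<integral>\<^sup>+t. h (M j X y) (pdt_out I t X) \<partial>R j y)"
        proof (rule nn_integral_cong_AE, rule AE_pmfI)
          fix t assume "t \<in> set_pmf (R j y)"
          from pdt_out_component[OF finite_lessThan _ on[OF this, unfolded I_def], of X] that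
          show "(of_bool (pdt_out A (component_pdt j t) (\<lambda>i. X (j, i)) \<noteq> f (\<lambda>i. X (j, i))) :: ennreal)
            = h (M j X y) (pdt_out I t X)" by (simp add: I_def h_def M_def)
        qed
        also have "\<dots> = (\<integral>\<^sup>+t. h (M j X y) (pdt_out I t (M j X y)) \<partial>R j y)"
          by (rule nn_integral_out_cong[OF simulatesD(2)[OF R(1)]]) (simp add: M_def)
        finally show ?thesis by (simp only: R_M[of j y X, symmetric])
      qed
      then have "(\<integral>\<^sup>+X. \<integral>\<^sup>+y. \<integral>\<^sup>+t. of_bool (pdt_out A (component_pdt j t) (\<lambda>i. X (j, i))
          \<noteq> f (\<lambda>i. X (j, i))) \<partial>R j y \<partial>P \<partial>P)
        = (\<integral>\<^sup>+x. \<integral>\<^sup>+t. h x (pdt_out I t x) \<partial>R j x \<partial>P)"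
        by (simp only: int_M[of "\<lambda>x. \<integral>\<^sup>+t. h x (pdt_out I t x) \<partial>R j x"])
      also have "\<dots> = (\<integral>\<^sup>+x. \<integral>\<^sup>+z. h x (pdt_out I T (\<lambda>i. if j < fst i then z i else x i)) \<partial>P \<partial>P)"
        by (simp only: simulatesD(3)[OF R(1)])
      also have "\<dots> = (\<integral>\<^sup>+x. \<integral>\<^sup>+z. (\<lambda>w. h w (pdt_out I T w))
          (\<lambda>i. if i \<in> {i. \<not> j < fst i} then x i else z i) \<partial>P \<partial>P)"
        unfolding merge_eq by (simp add: h_def)
      also have "\<dots> = (\<integral>\<^sup>+w. h w (pdt_out I T w) \<partial>P)"
        by (rule nn_integral_Pi_pmf_merge[OF finite_I])
      \<comment> \<open>A wrong component \<open>j\<close> makes the whole tuple wrong.\<close>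
      also have "\<dots> \<le> ?E"
        using that by (intro nn_integral_mono) (auto simp: h_def fun_power_def)
      finally show ?thesis .
    qed
    then have "(\<Sum>j<k. \<integral>\<^sup>+X. \<integral>\<^sup>+y. \<integral>\<^sup>+t. of_bool (pdt_out A (component_pdt j t) (\<lambda>i. X (j, i))
        \<noteq> f (\<lambda>i. X (j, i))) \<partial>R j y \<partial>P \<partial>P) \<le> (\<Sum>j<k. ?E)"
      by (intro sum_mono) simp
    then have "(\<integral>\<^sup>+t. \<integral>\<^sup>+x. of_bool (pdt_out A t x \<noteq> f x) \<partial>\<mu> \<partial>S) \<le> (\<Sum>j<k. ?E) / of_nat k"
      unfolding int_S by (rule divide_right_mono_ennreal)
    also have "\<dots> = ?E"
    proof -
      have "of_nat k / of_nat k = (1 :: ennreal)"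
        using \<open>0 < k\<close> by (intro ennreal_divide_self) (auto simp: of_nat_less_top)
      then show ?thesis
        by (simp add: ennreal_times_divide[symmetric] mult.commute[of "of_nat k"])
    qed
    finally show ?thesis by (simp only: P)
  qed
  ultimately show ?thesis by blast
qed

text \<open>Each deterministic tree in the support is simulated separately, and both bounds pass to
  the mixture by linearity. The factor is the reciprocal of \<open>2 / (l * real k)\<close>.\<close>

lemma direct_sum_bound:
  fixes B :: "'i \<Rightarrow> bit pmf" and A :: "'i set" and k :: nat
  defines "\<mu> \<equiv> Pi_pmf A 0 B" and "I \<equiv> {..<k} \<times> A"
  assumes "finite A" "0 < l" "0 < k" "\<And>i v. i \<in> A \<Longrightarrow> l / 2 \<le> pmf (B i) v"
  shows "ennreal (1 / 2 * real k * l) * avg_complexity A UNIV \<epsilon> f \<mu>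
    \<le> avg_complexity I (cube {..<k}) \<epsilon> (fun_power k f) (pmf_power k \<mu>)"
  unfolding avg_complexity_def[of I]
proof (rule Inf_greatest, clarify)
  fix R :: "(nat \<times> 'i, nat \<Rightarrow> bit) pdt pmf"
  assume R: "rpdt_on I (cube {..<k}) R" "err I (fun_power k f) R (pmf_power k \<mu>) \<le> \<epsilon>"
  define good where "good T S \<longleftrightarrow> rpdt_on A UNIV S \<and>
    (\<integral>\<^sup>+t. \<integral>\<^sup>+x. of_nat (pdt_queries A t x) \<partial>\<mu> \<partial>S)
      \<le> ennreal (2 / (l * real k)) * (\<integral>\<^sup>+x. of_nat (pdt_queries I T x) \<partial>pmf_power k \<mu>) \<and>
    (\<integral>\<^sup>+t. \<integral>\<^sup>+x. of_bool (pdt_out A t x \<noteq> f x) \<partial>\<mu> \<partial>S)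
      \<le> (\<integral>\<^sup>+x. of_bool (pdt_out I T x \<noteq> fun_power k f x) \<partial>pmf_power k \<mu>)" for T S
  have "\<exists>S. good T S" if "T \<in> set_pmf R" for T
    using component_simulation[OF assms(3-6), where T = T and f = f] R(1) that
    unfolding good_def \<mu>_def I_def rpdt_on_def by auto
  then obtain S where S: "\<And>T. T \<in> set_pmf R \<Longrightarrow> good T (S T)" by metis
  let ?S = "bind_pmf R S"
  have "rpdt_on A UNIV ?S"
    using S by (auto simp: good_def rpdt_on_def)
  moreover have "err A f ?S \<mu> \<le> \<epsilon>"
  proof -
    have "ennreal (err A f ?S \<mu>) \<le> ennreal (err I (fun_power k f) R (pmf_power k \<mu>))"
      unfolding ennreal_err_eq nn_integral_bind_pmf
      using S by (intro nn_integral_mono_AE AE_pmfI) (auto simp: good_def)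
    then show ?thesis using R(2) by (simp add: err_def)
  qed
  ultimately have "avg_complexity A UNIV \<epsilon> f \<mu> \<le> expected_queries A ?S \<mu>"
    unfolding avg_complexity_def by (intro Inf_lower) blast
  also have "\<dots> \<le> ennreal (2 / (l * real k)) * expected_queries I R (pmf_power k \<mu>)"
    unfolding expected_queries_eq nn_integral_bind_pmf
    unfolding nn_integral_pmf_cmult[where p = R, symmetric]
    using S by (intro nn_integral_mono_AE AE_pmfI) (auto simp: good_def)
  finally have "ennreal (1 / 2 * real k * l) * avg_complexity A UNIV \<epsilon> f \<mu>
    \<le> ennreal (1 / 2 * real k * l) * (ennreal (2 / (l * real k)) * expected_queries I R (pmf_power k \<mu>))"
    by (rule mult_left_mono) simp
  also have "\<dots> = expected_queries I R (pmf_power k \<mu>)"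
    unfolding mult.assoc[symmetric] using \<open>0 < l\<close> \<open>0 < k\<close> by (simp flip: ennreal_mult)
  finally show "ennreal (1 / 2 * real k * l) * avg_complexity A UNIV \<epsilon> f \<mu>
    \<le> expected_queries I R (pmf_power k \<mu>)" .
qed

lemma bounded_product_distributionE:
  assumes "bounded_product_distribution l I \<mu>" "finite I"
  obtains B where "\<mu> = Pi_pmf I 0 B" "\<And>i v. i \<in> I \<Longrightarrow> l / 2 \<le> pmf (B i) v"
proof -
  from assms obtain q where \<mu>: "\<mu> = Pi_pmf I 0 (\<lambda>i. map_pmf of_bool (bernoulli_pmf (q i)))"
    and l: "\<And>i. i \<in> I \<Longrightarrow> measure_pmf.prob \<mu> {x. x i = 1} \<in> {l / 2 .. 1 - l / 2}"
    by (auto simp: bounded_product_distribution_def product_distribution_def)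
  define B :: "'a \<Rightarrow> bit pmf" where "B i = map_pmf of_bool (bernoulli_pmf (q i))" for i
  have "l / 2 \<le> pmf (B i) v" if "i \<in> I" for i v
  proof -
    have "B i = map_pmf (\<lambda>x. x i) \<mu>"
      using assms(2) that by (simp add: \<mu> B_def Pi_pmf_component)
    then have "pmf (B i) 1 = measure_pmf.prob \<mu> {x. x i = 1}"
      by (simp add: pmf_map vimage_def)
    \<comment> \<open>The upper bound on the probability of 1 is the lower bound for 0.\<close>
    with l[OF that] pmf_bit_sum[of "B i"] show ?thesis by (cases v) auto
  qed
  moreover have "\<mu> = Pi_pmf I 0 B" unfolding \<mu> B_def ..
  ultimately show thesis by (rule that[rotated])
qed

theorem theorem13:
  "\<exists>c::real. c > 0 \<and>
     (\<forall>(n::nat) (k::nat) (f :: (nat \<Rightarrow> bit) \<Rightarrow> bit) (l::real) (\<mu> :: (nat \<Rightarrow> bit) pmf) (\<epsilon>::real).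
        n \<ge> 1 \<longrightarrow> k \<ge> 1 \<longrightarrow> 0 < l \<longrightarrow> l \<le> 1 \<longrightarrow>
        bounded_product_distribution l {..<n} \<mu> \<longrightarrow> \<epsilon> \<ge> 0 \<longrightarrow>
        avg_complexity ({..<k} \<times> {..<n}) (cube {..<k}) \<epsilon> (fun_power k f) (pmf_power k \<mu>)
          \<ge> ennreal (c * real k * l) * avg_complexity {..<n} UNIV \<epsilon> f \<mu>)"
proof (intro exI[of _ "1 / 2"] conjI allI impI)
  fix n k :: nat and f :: "(nat \<Rightarrow> bit) \<Rightarrow> bit" and l \<epsilon> :: real and \<mu> :: "(nat \<Rightarrow> bit) pmf"
  assume "1 \<le> k" "0 < l" and \<mu>: "bounded_product_distribution l {..<n} \<mu>"
  obtain B where B: "\<mu> = Pi_pmf {..<n} 0 B" "\<And>i v. i \<in> {..<n} \<Longrightarrow> l / 2 \<le> pmf (B i) v"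
    using bounded_product_distributionE[OF \<mu>] by blast
  \<comment> \<open>The constant \<open>1 / 2\<close> stems from the charge of at most two real
    queries per revealed coordinate.\<close>
  show "ennreal (1 / 2 * real k * l) * avg_complexity {..<n} UNIV \<epsilon> f \<mu>
    \<le> avg_complexity ({..<k} \<times> {..<n}) (cube {..<k}) \<epsilon> (fun_power k f) (pmf_power k \<mu>)"
    unfolding B(1) using \<open>1 \<le> k\<close> \<open>0 < l\<close> B(2) by (intro direct_sum_bound) simp_all
qed simp

end
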